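(* Let $G$ be a group and let $n\ge 3$ be an integer. Let $A$ and $B$ be the sets of ordered generating $(n-1)$-tuples of $G$ defined in the context. Then the map $\varphi: A\to B$ given by $$\varphi(\sigma_1,\ldots,\sigma_{n-1})=(\sigma_1,\ \sigma_1\sigma_2,\ \ldots,\ \sigma_1\sigma_2\cdots\sigma_{n-1})$$ is (well defined and) a bijection.
   Context: Write $o(x)\in\{1,2,\ldots\}\cup\{\infty\}$ for the order of a group element $x$. Definition of $A$. $A$ is the set of all ordered tuples $(\sigma_1,\ldots,\sigma_{n-1})$ of elements of $G$ such that $G=\langle \sigma_1,\ldots,\sigma_{n-1}\rangle$ and: (i) $o(\sigma_i)>2$ for every $1\le i\le n-1$ (infinite order is allowed); (ii) $(\sigma_i\sigma_{i+1}\cdots\sigma_j)^2=1$ for all $1\le i<j\le n-1$; (iii) (intersection property) put $\tau_{i,j}:=\sigma_i\sigma_{i+1}\cdots\sigma_j$ for $1\le i\le j\le n-1$, and $\tau_{0,j}:=1$ for $0\le j\le n$, $\tau_{i,n}:=1$ for $0\le i\le n$. For $I\subseteq\{-1,0,1,\ldots,n\}$ put $A_I:=\langle \tau_{r,s} \mid r\le s,\ r-1\in I,\ s\in I\rangle$. Then $A_I\cap A_J=A_{I\cap J}$ for all $I,J\subseteq\{-1,0,1,\ldots,n\}$. Definition of $B$. $B$ is the set of all ordered tuples $(\alpha_1,\ldots,\alpha_{n-1})$ of elements of $G$ such that $G=\langle\alpha_1,\ldots,\alpha_{n-1}\rangle$ and, with $\alpha_0:=1$, $\alpha_{i,j}:=\alpha_i^{-1}\alpha_j$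 for $0\le i,j\le n-1$, and $G_J^+:=\langle \alpha_{i,j}\mid i,j\in J\rangle$ for $J\subseteq\{0,\ldots,n-1\}$: (i) $G_J^+\cap G_K^+=G_{J\cap K}^+$ for all $J,K\subseteq\{0,\ldots,n-1\}$ with $|J|,|K|\ge 2$; (ii) for $i,j\in\{0,\ldots,n-1\}$: $o(\alpha_i^{-1}\alpha_j)=2$ if $|i-j|\ge 2$, and $o(\alpha_i^{-1}\alpha_j)\ne 2$ if $|i-j|=1$. *)

theory Defs
  imports "HOL-Algebra.Algebra" "HOL-Library.Extended_Nat" "HOL-Library.FuncSet"
begin

(* The library's group.ord is 0 for elements of infinite order. *)
definition elem_order :: "('a, 'b) monoid_scheme \<Rightarrow> 'a \<Rightarrow> enat" where
  "elem_order G x = (if group.ord G x = 0 then \<infinity> else enat (group.ord G x))"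

(* An ordered (n-1)-tuple of elements of G is an extensional function on {1..n-1}.
   All indices are integers, since the index sets I of the intersection property
   range over subsets of {-1..n}. *)
definition tuples :: "('a, 'b) monoid_scheme \<Rightarrow> int \<Rightarrow> (int \<Rightarrow> 'a) set" where
  "tuples G n = {1..n - 1} \<rightarrow>\<^sub>E carrier G"

(* s_i s_(i+1) ... s_j, multiplied in this order (G need not be abelian). *)
definition consec_prod :: "('a, 'b) monoid_scheme \<Rightarrow> (int \<Rightarrow> 'a) \<Rightarrow> int \<Rightarrow> int \<Rightarrow> 'a" where
  "consec_prod G s i j = foldr (\<lambda>k x. s k \<otimes>\<^bsub>G\<^esub> x) [i..j] \<one>\<^bsub>G\<^esub>"

definition tau :: "('a, 'b) monoid_scheme \<Rightarrow> int \<Rightarrow> (int \<Rightarrow> 'a) \<Rightarrow> int \<Rightarrow> int \<Rightarrow> 'a" where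
  "tau G n s i j = (if i = 0 \<or> j = n then \<one>\<^bsub>G\<^esub> else consec_prod G s i j)"

definition A_sub :: "('a, 'b) monoid_scheme \<Rightarrow> int \<Rightarrow> (int \<Rightarrow> 'a) \<Rightarrow> int set \<Rightarrow> 'a set" where
  "A_sub G n s I = generate G {tau G n s p q | p q. p \<le> q \<and> p - 1 \<in> I \<and> q \<in> I}"

definition set_A :: "('a, 'b) monoid_scheme \<Rightarrow> int \<Rightarrow> (int \<Rightarrow> 'a) set" where
  "set_A G n = {s \<in> tuples G n.
     carrier G = generate G (s ` {1..n - 1}) \<and>
     (\<forall>i\<in>{1..n - 1}. elem_order G (s i) > 2) \<and>
     (\<forall>i j. 1 \<le> i \<and> i < j \<and> j \<le> n - 1 \<longrightarrow>
        consec_prod G s i j [^]\<^bsub>G\<^esub> (2::nat) = \<one>\<^bsub>G\<^esub>) \<and>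
     (\<forall>I J. I \<subseteq> {-1..n} \<and> J \<subseteq> {-1..n} \<longrightarrow>
        A_sub G n s I \<inter> A_sub G n s J = A_sub G n s (I \<inter> J))}"

(* alpha_i^(-1) alpha_j, with the convention alpha_0 = 1 *)
definition alpha_quot :: "('a, 'b) monoid_scheme \<Rightarrow> (int \<Rightarrow> 'a) \<Rightarrow> int \<Rightarrow> int \<Rightarrow> 'a" where
  "alpha_quot G a i j =
     inv\<^bsub>G\<^esub> (if i = 0 then \<one>\<^bsub>G\<^esub> else a i) \<otimes>\<^bsub>G\<^esub> (if j = 0 then \<one>\<^bsub>G\<^esub> else a j)"

definition G_plus :: "('a, 'b) monoid_scheme \<Rightarrow> (int \<Rightarrow> 'a) \<Rightarrow> int set \<Rightarrow> 'a set" where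
  "G_plus G a J = generate G {alpha_quot G a i j | i j. i \<in> J \<and> j \<in> J}"

definition set_B :: "('a, 'b) monoid_scheme \<Rightarrow> int \<Rightarrow> (int \<Rightarrow> 'a) set" where
  "set_B G n = {a \<in> tuples G n.
     carrier G = generate G (a ` {1..n - 1}) \<and>
     (\<forall>J K. J \<subseteq> {0..n - 1} \<and> K \<subseteq> {0..n - 1} \<and> card J \<ge> 2 \<and> card K \<ge> 2 \<longrightarrow>
        G_plus G a J \<inter> G_plus G a K = G_plus G a (J \<inter> K)) \<and>
     (\<forall>i\<in>{0..n - 1}. \<forall>j\<in>{0..n - 1}.
        (\<bar>i - j\<bar> \<ge> 2 \<longrightarrow> elem_order G (alpha_quot G a i j) = 2) \<and>
        (\<bar>i - j\<bar> = 1 \<longrightarrow> elem_order G (alpha_quot G a i j) \<noteq> 2))}"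

definition phi :: "('a, 'b) monoid_scheme \<Rightarrow> int \<Rightarrow> (int \<Rightarrow> 'a) \<Rightarrow> (int \<Rightarrow> 'a)" where
  "phi G n s = (\<lambda>j\<in>{1..n - 1}. consec_prod G s 1 j)"

end

theory Submission
  imports Defs
begin

text \<open>
  Why the map is a bijection. Writing \<open>\<alpha> = phi \<sigma>\<close> and \<open>\<alpha>\<^sub>0 = 1\<close>, products of consecutive entries of
  \<open>\<sigma>\<close> telescope: \<open>\<sigma>\<^bsub>i+1\<^esub> \<cdots> \<sigma>\<^sub>j = \<alpha>\<^sub>i\<inverse> \<alpha>\<^sub>j\<close> for \<open>i \<le> j\<close> (\<open>alpha_quot_phi\<close>). In particular
  \<open>\<sigma>\<^sub>i = \<alpha>\<^bsub>i-1\<^esub>\<inverse> \<alpha>\<^sub>i\<close>, so \<open>phi\<close> is invertible on the set of all tuples (\<open>bij_betw_phi_tuples\<close>), and it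
  remains to see that \<open>\<sigma>\<close> satisfies the axioms of the first set iff \<open>\<alpha>\<close> satisfies those of the
  second (\<open>phi_in_set_B_iff\<close>).

  Both tuples generate the same subgroup. By telescoping, the subgroup attached to
  \<open>I \<subseteq> {-1..n}\<close> on the one side is the subgroup attached to \<open>I \<inter> {0..n-1}\<close> on the other, since the
  indices \<open>-1\<close> and \<open>n\<close> only contribute the identity (\<open>A_sub_eq_G_plus\<close>). An index set with at most
  one element gives the trivial subgroup, for which the intersection property is automatic; so
  it is enough to compare index sets with at least two elements, and the two intersection properties
  are equivalent.

  The conditions on orders are not literal translations of each other: on the one side the products
  of length at least 2 only have to square to 1, on the other the \<open>\<sigma>\<^sub>i\<close> only have to be no
  involutions, and in each case the identity must be excluded. If \<open>\<alpha>\<^sub>i = \<alpha>\<^sub>j\<close> with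
  \<open>|i - j| \<ge> 2\<close>, then for a neighbour \<open>k\<close> of \<open>i\<close> the element \<open>\<alpha>\<^sub>i\<inverse> \<alpha>\<^sub>k\<close> lies in the
  subgroups attached to \<open>{i, k}\<close> and to \<open>{j, k}\<close>, hence in the trivial one attached to \<open>{k}\<close>,
  so \<open>\<alpha>\<^sub>i = \<alpha>\<^sub>k\<close>, contradicting the nontriviality of the \<open>\<sigma>\<close>'s. Conversely, if two neighbours agree,
  \<open>\<alpha>\<^bsub>i-1\<^esub> = \<alpha>\<^sub>i\<close>, then \<open>n \<ge> 3\<close> provides an index \<open>k\<close> adjacent to one of them and at distance 2 from
  the other, and the same element \<open>\<alpha>\<^sub>k\<inverse> \<alpha>\<^sub>i\<close> would both be and not be an involution.
\<close>

context group
begin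

section \<open>Orders of elements\<close>

lemma elem_order_eq_2_iff:
  assumes "x \<in> carrier G"
  shows "elem_order G x = 2 \<longleftrightarrow> x \<noteq> \<one> \<and> x [^] (2::nat) = \<one>"
proof -
  have "elem_order G x = 2 \<longleftrightarrow> ord x = 2"
    by (auto simp: elem_order_def numeral_eq_enat)
  moreover have "ord x dvd 2 \<longleftrightarrow> ord x = 1 \<or> ord x = 2"
    using prime_nat_iff[of 2] two_is_prime_nat by auto
  moreover have "ord x = 1 \<longleftrightarrow> x = \<one>"
    using assms ord_eq_1 by blast
  ultimately show ?thesis
    using assms pow_eq_id[of x 2] by (metis one_eq_numeral_iff semiring_norm(85))
qed

lemma elem_order_gt_2_iff:
  assumes "x \<in> carrier G"
  shows "elem_order G x > 2 \<longleftrightarrow> x \<noteq> \<one> \<and> elem_order G x \<noteq> 2"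
proof -
  have "elem_order G x > 2 \<longleftrightarrow> ord x \<noteq> 1 \<and> ord x \<noteq> 2"
    by (auto simp: elem_order_def numeral_eq_enat)
  moreover have "elem_order G x = 2 \<longleftrightarrow> ord x = 2"
    by (auto simp: elem_order_def numeral_eq_enat)
  moreover have "ord x = 1 \<longleftrightarrow> x = \<one>"
    using assms ord_eq_1 by blast
  ultimately show ?thesis by simp
qed

section \<open>Telescoping of consecutive products\<close>

lemma consec_prod_in_subgroup:
  assumes "subgroup H G" and "s ` {i..j} \<subseteq> H"
  shows "consec_prod G s i j \<in> H"
proof -
  have "foldr (\<lambda>k x. s k \<otimes> x) ks \<one> \<in> H" if "s ` set ks \<subseteq> H" for ks
    using that assms(1) by (induction ks) (auto simp: subgroup.one_closed subgroup.m_closed)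
  then show ?thesis
    using assms(2) by (simp add: consec_prod_def)
qed

lemma consec_prod_closed:
  "s ` {i..j} \<subseteq> carrier G \<Longrightarrow> consec_prod G s i j \<in> carrier G"
  by (rule consec_prod_in_subgroup[OF subgroup_self])

lemma consec_prod_empty: "j < i \<Longrightarrow> consec_prod G s i j = \<one>"
  by (simp add: consec_prod_def)

lemma consec_prod_append:
  assumes "s ` {i..k} \<subseteq> carrier G" and "i \<le> j + 1" and "j \<le> k"
  shows "consec_prod G s i k = consec_prod G s i j \<otimes> consec_prod G s (j + 1) k"
proof -
  have foldr_mult: "foldr (\<lambda>k x. s k \<otimes> x) ks y = foldr (\<lambda>k x. s k \<otimes> x) ks \<one> \<otimes> y
        \<and> foldr (\<lambda>k x. s k \<otimes> x) ks \<one> \<in> carrier G"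
    if "s ` set ks \<subseteq> carrier G" "y \<in> carrier G" for ks y
    using that by (induction ks) (auto simp: m_assoc)
  have split: "[i..k] = [i..j] @ [j + 1..k]"
  proof (cases "i \<le> j")
    case True
    then show ?thesis using assms(3) upto_split2[of i j k] by simp
  next
    case False
    then have "j + 1 = i" using assms(2) by simp
    then show ?thesis using False by simp
  qed
  have "consec_prod G s (j + 1) k \<in> carrier G"
    using assms by (intro consec_prod_closed) auto
  moreover have "s ` set [i..j] \<subseteq> carrier G"
    using assms by auto
  ultimately show ?thesis
    using foldr_mult[of "[i..j]" "consec_prod G s (j + 1) k"]
    by (simp add: consec_prod_def split)
qed

lemma tuple_image_subset: "s \<in> tuples G n \<Longrightarrow> 1 \<le> i \<Longrightarrow> j \<le> n - 1 \<Longrightarrow> s ` {i..j} \<subseteq> carrier G"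
  by (auto simp: tuples_def PiE_def Pi_def)

lemma alpha_quot_closed:
  assumes "a \<in> tuples G n" and "i \<in> {0..n - 1}" and "j \<in> {0..n - 1}"
  shows "alpha_quot G a i j \<in> carrier G"
  using assms by (auto simp: alpha_quot_def tuples_def PiE_def Pi_def)

lemma inv_alpha_quot:
  assumes "a \<in> tuples G n" and "i \<in> {0..n - 1}" and "j \<in> {0..n - 1}"
  shows "inv (alpha_quot G a i j) = alpha_quot G a j i"
  using assms by (auto simp: alpha_quot_def tuples_def PiE_def Pi_def inv_mult_group)

lemma alpha_quot_self:
  assumes "a \<in> tuples G n" and "i \<in> {0..n - 1}"
  shows "alpha_quot G a i i = \<one>"
  using assms by (auto simp: alpha_quot_def tuples_def PiE_def Pi_def)

lemma alpha_quot_mult: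
  assumes "a \<in> tuples G n" and "i \<in> {0..n - 1}" and "j \<in> {0..n - 1}" and "k \<in> {0..n - 1}"
  shows "alpha_quot G a i j \<otimes> alpha_quot G a j k = alpha_quot G a i k"
proof -
  have "inv x \<otimes> y \<otimes> (inv y \<otimes> z) = inv x \<otimes> z"
    if "x \<in> carrier G" "y \<in> carrier G" "z \<in> carrier G" for x y z
    using that by (simp add: m_assoc flip: m_assoc[of y "inv y" z])
  moreover have "(if l = 0 then \<one> else a l) \<in> carrier G" if "l \<in> {0..n - 1}" for l
    using assms(1) that by (auto simp: tuples_def PiE_def Pi_def)
  ultimately show ?thesis
    unfolding alpha_quot_def using assms by blast
qed

lemma phi_in_tuples: "s \<in> tuples G n \<Longrightarrow> phi G n s \<in> tuples G n"
  using consec_prod_closed[OF tuple_image_subset] by (auto simp: tuples_def phi_def)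

lemma alpha_quot_phi:
  assumes s: "s \<in> tuples G n" and ij: "0 \<le> i" "i \<le> j" "j \<le> n - 1"
  shows "alpha_quot G (phi G n s) i j = consec_prod G s (i + 1) j"
proof -
  \<comment> \<open>The convention \<open>\<alpha>\<^sub>0 = 1\<close> agrees with the value of the empty product.\<close>
  have phi: "(if k = 0 then \<one> else phi G n s k) = consec_prod G s 1 k" if "0 \<le> k" "k \<le> n - 1" for k
    using that by (auto simp: phi_def consec_prod_empty)
  have cl: "consec_prod G s k l \<in> carrier G" if "1 \<le> k" "l \<le> n - 1" for k l
    using consec_prod_closed[OF tuple_image_subset[OF s that]] .
  have "consec_prod G s 1 j = consec_prod G s 1 i \<otimes> consec_prod G s (i + 1) j"
    using ij by (intro consec_prod_append tuple_image_subset[OF s]) auto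
  moreover have "consec_prod G s 1 i \<in> carrier G" "consec_prod G s (i + 1) j \<in> carrier G"
    using ij by (auto intro!: cl)
  ultimately show ?thesis
    unfolding alpha_quot_def using ij by (simp add: phi inv_solve_left' flip: m_assoc)
qed

lemma alpha_quot_phi_neighbours:
  assumes "s \<in> tuples G n" and "i \<in> {1..n - 1}"
  shows "alpha_quot G (phi G n s) (i - 1) i = s i"
proof -
  have "s i \<in> carrier G"
    using assms by (auto simp: tuples_def)
  then show ?thesis
    using alpha_quot_phi[of s n "i - 1" i] assms by (simp add: consec_prod_def)
qed

text \<open>The inverse map sends \<open>\<alpha>\<close> to the tuple of quotients \<open>\<alpha>\<^bsub>i-1\<^esub>\<inverse> \<alpha>\<^sub>i\<close>, whose consecutive products
  telescope back to \<open>\<alpha>\<close>.\<close>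

lemma bij_betw_phi_tuples: "bij_betw (phi G n) (tuples G n) (tuples G n)"
proof -
  define psi where "psi a = (\<lambda>i\<in>{1..n - 1}. alpha_quot G a (i - 1) i)" for a
  have psi_tuples: "psi a \<in> tuples G n" if "a \<in> tuples G n" for a
    using alpha_quot_closed[OF that] by (auto simp: psi_def tuples_def)
  show ?thesis
  proof (rule bij_betw_byWitness[where f' = psi])
    show "\<forall>s\<in>tuples G n. psi (phi G n s) = s"
    proof
      fix s assume s: "s \<in> tuples G n"
      show "psi (phi G n s) = s"
      proof
        fix i show "psi (phi G n s) i = s i"
          using alpha_quot_phi_neighbours[OF s, of i] s
          by (cases "i \<in> {1..n - 1}") (auto simp: psi_def tuples_def PiE_def extensional_def)
      qed
    qed
    show "\<forall>a\<in>tuples G n. phi G n (psi a) = a"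
    proof
      fix a assume a: "a \<in> tuples G n"
      have telescope: "consec_prod G (psi a) 1 j = alpha_quot G a 0 j" if "0 \<le> j" "j \<le> n - 1" for j
        using that
      proof (induction j rule: int_ge_induct)
        case base
        then show ?case
          using alpha_quot_self[OF a, of 0] by (simp add: consec_prod_empty)
      next
        case (step j)
        have "consec_prod G (psi a) 1 (j + 1)
            = consec_prod G (psi a) 1 j \<otimes> consec_prod G (psi a) (j + 1) (j + 1)"
          using step by (intro consec_prod_append tuple_image_subset[OF psi_tuples[OF a]]) auto
        also have "consec_prod G (psi a) (j + 1) (j + 1) = alpha_quot G a j (j + 1)"
          using step alpha_quot_closed[OF a, of j "j + 1"] by (simp add: consec_prod_def psi_def)
        also have "consec_prod G (psi a) 1 j = alpha_quot G a 0 j"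
          using step by simp
        finally show ?case
          using step by (simp add: alpha_quot_mult[OF a])
      qed
      show "phi G n (psi a) = a"
      proof
        fix j show "phi G n (psi a) j = a j"
          using telescope[of j] a
          by (cases "j \<in> {1..n - 1}")
            (auto simp: phi_def alpha_quot_def tuples_def PiE_def Pi_def extensional_def)
      qed
    qed
  qed (use phi_in_tuples psi_tuples in auto)
qed

section \<open>Comparison of the attached subgroups\<close>

lemma generate_subset_iff:
  "S \<subseteq> carrier G \<Longrightarrow> T \<subseteq> carrier G \<Longrightarrow> generate G S \<subseteq> generate G T \<longleftrightarrow> S \<subseteq> generate G T"
  by (metis generate.incl generate_is_subgroup generate_subgroup_incl subset_iff)

lemma generate_phi:
  assumes s: "s \<in> tuples G n"
  shows "generate G (phi G n s ` {1..n - 1}) = generate G (s ` {1..n - 1})"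
proof -
  let ?a = "phi G n s"
  have cl: "s ` {1..n - 1} \<subseteq> carrier G" "?a ` {1..n - 1} \<subseteq> carrier G"
    using tuple_image_subset s phi_in_tuples[OF s] by auto
  have "?a ` {1..n - 1} \<subseteq> generate G (s ` {1..n - 1})"
  proof (rule image_subsetI)
    fix j assume j: "j \<in> {1..n - 1}"
    then have "s ` {1..j} \<subseteq> generate G (s ` {1..n - 1})"
      by (auto intro!: generate.incl)
    then show "?a j \<in> generate G (s ` {1..n - 1})"
      using j consec_prod_in_subgroup[OF generate_is_subgroup[OF cl(1)]] by (simp add: phi_def)
  qed
  moreover have "s ` {1..n - 1} \<subseteq> generate G (?a ` {1..n - 1})"
  proof (rule image_subsetI)
    fix i assume i: "i \<in> {1..n - 1}"
    have sub: "subgroup (generate G (?a ` {1..n - 1})) G"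
      by (rule generate_is_subgroup[OF cl(2)])
    have mem: "(if k = 0 then \<one> else ?a k) \<in> generate G (?a ` {1..n - 1})" if "k \<in> {0..n - 1}" for k
      using that by (auto intro!: generate.incl generate.one)
    have "alpha_quot G ?a (i - 1) i \<in> generate G (?a ` {1..n - 1})"
      unfolding alpha_quot_def using i
      by (intro subgroup.m_closed[OF sub] subgroup.m_inv_closed[OF sub] mem) auto
    then show "s i \<in> generate G (?a ` {1..n - 1})"
      using alpha_quot_phi_neighbours[OF s i] by simp
  qed
  ultimately show ?thesis
    using generate_subset_iff cl by blast
qed

lemma G_plus_generators_closed:
  assumes "a \<in> tuples G n" and "J \<subseteq> {0..n - 1}"
  shows "{alpha_quot G a i j | i j. i \<in> J \<and> j \<in> J} \<subseteq> carrier G"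
  using alpha_quot_closed[OF assms(1)] assms(2) by blast

lemma subgroup_G_plus:
  "a \<in> tuples G n \<Longrightarrow> J \<subseteq> {0..n - 1} \<Longrightarrow> subgroup (G_plus G a J) G"
  unfolding G_plus_def by (intro generate_is_subgroup G_plus_generators_closed)

lemma alpha_quot_in_G_plus: "i \<in> J \<Longrightarrow> j \<in> J \<Longrightarrow> alpha_quot G a i j \<in> G_plus G a J"
  unfolding G_plus_def by (auto intro: generate.incl)

lemma G_plus_trivial:
  assumes a: "a \<in> tuples G n" and J: "J \<subseteq> {0..n - 1}" "card J < 2"
  shows "G_plus G a J = {\<one>}"
proof -
  have "finite J"
    using J(1) finite_subset by blast
  then have "i = j" if "i \<in> J" "j \<in> J" for i j
    using that J(2) card_le_Suc0_iff_eq[of J] by auto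
  then have "{alpha_quot G a i j | i j. i \<in> J \<and> j \<in> J} \<subseteq> {\<one>}"
    using alpha_quot_self[OF a] J(1) by blast
  then have "G_plus G a J \<subseteq> {\<one>}"
    unfolding G_plus_def by (intro generate_subgroup_incl triv_subgroup)
  then show ?thesis
    using generate.one unfolding G_plus_def by blast
qed

text \<open>The generators of the left-hand side are the quotients \<open>\<alpha>\<^sub>p\<inverse> \<alpha>\<^sub>q\<close> with \<open>p < q\<close> only; those with
  \<open>p > q\<close> are their inverses, and the indices \<open>-1\<close> and \<open>n\<close> contribute nothing but the identity.\<close>

lemma A_sub_eq_G_plus:
  assumes s: "s \<in> tuples G n" and I: "I \<subseteq> {-1..n}"
  shows "A_sub G n s I = G_plus G (phi G n s) (I \<inter> {0..n - 1})"
proof -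
  let ?a = "phi G n s" and ?J = "I \<inter> {0..n - 1}"
  let ?T = "{tau G n s p q | p q. p \<le> q \<and> p - 1 \<in> I \<and> q \<in> I}"
  let ?Q = "{alpha_quot G ?a i j | i j. i \<in> ?J \<and> j \<in> ?J}"
  have a: "?a \<in> tuples G n"
    by (rule phi_in_tuples[OF s])
  have tau: "tau G n s p q = alpha_quot G ?a (p - 1) q" if "1 \<le> p" "p \<le> q" "q \<le> n - 1" for p q
    using that alpha_quot_phi[OF s, of "p - 1" q] by (simp add: tau_def)
  have T_Q: "?T \<subseteq> G_plus G ?a ?J"
  proof clarify
    fix p q assume pq: "p \<le> q" "p - 1 \<in> I" "q \<in> I"
    show "tau G n s p q \<in> G_plus G ?a ?J"
    proof (cases "p = 0 \<or> q = n")
      case True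
      then show ?thesis
        using generate.one by (auto simp: tau_def G_plus_def)
    next
      case False
      moreover have "-1 \<le> p - 1" "q \<le> n"
        using pq I by auto
      ultimately show ?thesis
        using pq by (subst tau) (auto intro!: alpha_quot_in_G_plus)
    qed
  qed
  have Tcl: "?T \<subseteq> carrier G"
    using T_Q subgroup.subset[OF subgroup_G_plus[OF a, of ?J]] by auto
  have less: "alpha_quot G ?a i j \<in> A_sub G n s I" if "i \<in> ?J" "j \<in> ?J" "i < j" for i j
  proof -
    have T: "tau G n s (i + 1) j \<in> ?T"
      using that by (intro CollectI exI[of _ "i + 1"] exI[of _ j]) simp
    have "tau G n s (i + 1) j \<in> A_sub G n s I"
      unfolding A_sub_def by (rule generate.incl[OF T])
    moreover have "tau G n s (i + 1) j = alpha_quot G ?a i j"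
      using that tau[of "i + 1" j] by simp
    ultimately show ?thesis by simp
  qed
  have "?Q \<subseteq> A_sub G n s I"
  proof clarify
    fix i j assume ij: "i \<in> I" "i \<in> {0..n - 1}" "j \<in> I" "j \<in> {0..n - 1}"
    consider "i < j" | "i = j" | "j < i" by linarith
    then show "alpha_quot G ?a i j \<in> A_sub G n s I"
    proof cases
      case 1
      then show ?thesis using less ij by blast
    next
      case 2
      then show ?thesis
        using alpha_quot_self[OF a, of i] ij generate.one by (simp add: A_sub_def)
    next
      case 3
      then have "alpha_quot G ?a j i \<in> A_sub G n s I"
        using less ij by blast
      then have "inv (alpha_quot G ?a j i) \<in> A_sub G n s I"
        unfolding A_sub_def by (rule generate_m_inv_closed[OF Tcl])
      then show ?thesis
        using inv_alpha_quot[OF a] ij by simp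
    qed
  qed
  then have "G_plus G ?a ?J \<subseteq> A_sub G n s I"
    unfolding G_plus_def A_sub_def by (intro generate_subgroup_incl generate_is_subgroup[OF Tcl])
  moreover have "A_sub G n s I \<subseteq> G_plus G ?a ?J"
    unfolding A_sub_def by (intro generate_subgroup_incl T_Q subgroup_G_plus[OF a]) auto
  ultimately show ?thesis by blast
qed

text \<open>An index set with fewer than two elements gives the trivial subgroup, whose intersection with any
  other subgroup is trivial; this covers the pairs \<open>J, K\<close> excluded on the right-hand side.\<close>

lemma intersection_property_iff:
  assumes s: "s \<in> tuples G n"
  shows "(\<forall>I J. I \<subseteq> {-1..n} \<and> J \<subseteq> {-1..n} \<longrightarrow>
             A_sub G n s I \<inter> A_sub G n s J = A_sub G n s (I \<inter> J)) \<longleftrightarrow>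
         (\<forall>J K. J \<subseteq> {0..n - 1} \<and> K \<subseteq> {0..n - 1} \<and> card J \<ge> 2 \<and> card K \<ge> 2 \<longrightarrow>
             G_plus G (phi G n s) J \<inter> G_plus G (phi G n s) K = G_plus G (phi G n s) (J \<inter> K))"
    (is "?A \<longleftrightarrow> ?B")
proof
  let ?a = "phi G n s"
  have a: "?a \<in> tuples G n"
    by (rule phi_in_tuples[OF s])
  {
    assume A: ?A
    show ?B
    proof clarify
      fix J K assume JK: "J \<subseteq> {0..n - 1}" "K \<subseteq> {0..n - 1}"
      have eq: "A_sub G n s L = G_plus G ?a L" if "L \<subseteq> {0..n - 1}" for L
      proof -
        have "L \<subseteq> {-1..n}" "L \<inter> {0..n - 1} = L"
          using that by auto
        then show ?thesis
          using A_sub_eq_G_plus[OF s, of L] by simp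
      qed
      have sub: "J \<subseteq> {-1..n}" "K \<subseteq> {-1..n}" "J \<inter> K \<subseteq> {0..n - 1}"
        using JK by auto
      then show "G_plus G ?a J \<inter> G_plus G ?a K = G_plus G ?a (J \<inter> K)"
        using A[rule_format, of J K] eq JK by simp
    qed
  }
  {
    assume B: ?B
    have int: "G_plus G ?a J \<inter> G_plus G ?a K = G_plus G ?a (J \<inter> K)"
      if JK: "J \<subseteq> {0..n - 1}" "K \<subseteq> {0..n - 1}" for J K
    proof (cases "card J \<ge> 2 \<and> card K \<ge> 2")
      case True
      then show ?thesis using B JK by blast
    next
      case False
      have fin: "finite J" "finite K"
        using JK finite_subset by blast+
      have "card (J \<inter> K) < 2"
        using False card_mono[OF fin(1), of "J \<inter> K"] card_mono[OF fin(2), of "J \<inter> K"] by auto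
      then have "G_plus G ?a (J \<inter> K) = {\<one>}"
        using JK by (intro G_plus_trivial[OF a]) auto
      moreover have "G_plus G ?a J = {\<one>} \<or> G_plus G ?a K = {\<one>}"
        using False JK G_plus_trivial[OF a] by (meson not_le)
      moreover have "\<one> \<in> G_plus G ?a J" "\<one> \<in> G_plus G ?a K"
        by (simp_all add: G_plus_def generate.one)
      ultimately show ?thesis by auto
    qed
    show ?A
    proof clarify
      fix I J assume IJ: "I \<subseteq> {-1..n}" "J \<subseteq> {-1..n}"
      then have "I \<inter> J \<subseteq> {-1..n}"
        by auto
      moreover have "(I \<inter> {0..n - 1}) \<inter> (J \<inter> {0..n - 1}) = (I \<inter> J) \<inter> {0..n - 1}"
        by auto
      ultimately show "A_sub G n s I \<inter> A_sub G n s J = A_sub G n s (I \<inter> J)"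
        using IJ int[of "I \<inter> {0..n - 1}" "J \<inter> {0..n - 1}"] by (simp add: A_sub_eq_G_plus[OF s])
    qed
  }
qed

section \<open>Comparison of the order conditions\<close>

text \<open>The quotients for \<open>(i, j)\<close> and \<open>(j, i)\<close> are mutually inverse and hence have the same order, so only
  pairs with \<open>i < j\<close> matter; these are the consecutive products. On the right-hand side the condition is
  phrased for \<open>\<sigma>\<close> and differs from the order condition on \<open>\<sigma>\<close> only in how it treats the identity.\<close>

lemma alpha_quot_order_iff:
  assumes s: "s \<in> tuples G n"
  shows "(\<forall>i\<in>{0..n - 1}. \<forall>j\<in>{0..n - 1}.
            (\<bar>i - j\<bar> \<ge> 2 \<longrightarrow> elem_order G (alpha_quot G (phi G n s) i j) = 2) \<and>
            (\<bar>i - j\<bar> = 1 \<longrightarrow> elem_order G (alpha_quot G (phi G n s) i j) \<noteq> 2)) \<longleftrightarrow>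
         (\<forall>i j. 1 \<le> i \<and> i < j \<and> j \<le> n - 1 \<longrightarrow> elem_order G (consec_prod G s i j) = 2) \<and>
         (\<forall>i\<in>{1..n - 1}. elem_order G (s i) \<noteq> 2)"
    (is "?L \<longleftrightarrow> ?R")
proof
  let ?a = "phi G n s"
  have a: "?a \<in> tuples G n"
    by (rule phi_in_tuples[OF s])
  {
    assume L: ?L
    have "elem_order G (consec_prod G s i j) = 2" if "1 \<le> i" "i < j" "j \<le> n - 1" for i j
      using that L[rule_format, of "i - 1" j] alpha_quot_phi[OF s, of "i - 1" j] by simp
    moreover have "elem_order G (s i) \<noteq> 2" if "i \<in> {1..n - 1}" for i
      using that L[rule_format, of "i - 1" i] alpha_quot_phi_neighbours[OF s that] by simp
    ultimately show ?R by blast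
  }
  {
    assume R: ?R
    have sym: "elem_order G (alpha_quot G ?a i j) = elem_order G (alpha_quot G ?a j i)"
      if "i \<in> {0..n - 1}" "j \<in> {0..n - 1}" for i j
      using ord_inv[OF alpha_quot_closed[OF a that]] inv_alpha_quot[OF a that]
      by (simp add: elem_order_def)
    have less: "(2 \<le> j - i \<longrightarrow> elem_order G (alpha_quot G ?a i j) = 2) \<and>
        (j - i = 1 \<longrightarrow> elem_order G (alpha_quot G ?a i j) \<noteq> 2)"
      if "0 \<le> i" "i < j" "j \<le> n - 1" for i j
    proof (intro conjI impI)
      assume "2 \<le> j - i"
      then show "elem_order G (alpha_quot G ?a i j) = 2"
        using R that alpha_quot_phi[OF s, of i j] by simp
    next
      assume "j - i = 1"
      then have "i = j - 1"
        by simp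
      then show "elem_order G (alpha_quot G ?a i j) \<noteq> 2"
        using R that alpha_quot_phi_neighbours[OF s, of j] by simp
    qed
    show ?L
    proof (intro ballI)
      fix i j assume ij: "i \<in> {0..n - 1}" "j \<in> {0..n - 1}"
      consider "i < j" | "i = j" | "j < i" by linarith
      then show "(\<bar>i - j\<bar> \<ge> 2 \<longrightarrow> elem_order G (alpha_quot G ?a i j) = 2) \<and>
          (\<bar>i - j\<bar> = 1 \<longrightarrow> elem_order G (alpha_quot G ?a i j) \<noteq> 2)"
      proof cases
        case 1
        then show ?thesis using less[of i j] ij by auto
      next
        case 2
        then show ?thesis by simp
      next
        case 3
        then show ?thesis using less[of j i] sym[of i j] ij by auto
      qed
    qed
  }
qed

text \<open>If \<open>\<sigma>\<^sub>i \<cdots> \<sigma>\<^sub>j = 1\<close>, then \<open>\<alpha>\<^bsub>i-1\<^esub> = \<alpha>\<^sub>j\<close>, so \<open>\<sigma>\<^sub>i\<close> lies in the subgroups attached to \<open>{i - 1, i}\<close> and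
  to \<open>{i, j}\<close>, which meet trivially.\<close>

lemma consec_prod_nontrivial:
  assumes s: "s \<in> tuples G n"
    and int: "\<And>J K. J \<subseteq> {0..n - 1} \<Longrightarrow> K \<subseteq> {0..n - 1} \<Longrightarrow> card J \<ge> 2 \<Longrightarrow> card K \<ge> 2 \<Longrightarrow>
      G_plus G (phi G n s) J \<inter> G_plus G (phi G n s) K = G_plus G (phi G n s) (J \<inter> K)"
    and ij: "1 \<le> i" "i < j" "j \<le> n - 1" and ne: "s i \<noteq> \<one>"
  shows "consec_prod G s i j \<noteq> \<one>"
proof
  let ?a = "phi G n s"
  assume "consec_prod G s i j = \<one>"
  then have one: "alpha_quot G ?a (i - 1) j = \<one>"
    using alpha_quot_phi[OF s, of "i - 1" j] ij by simp
  have a: "?a \<in> tuples G n"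
    by (rule phi_in_tuples[OF s])
  have si: "alpha_quot G ?a (i - 1) i = s i"
    using alpha_quot_phi_neighbours[OF s, of i] ij by simp
  have "alpha_quot G ?a (i - 1) i = alpha_quot G ?a (i - 1) j \<otimes> alpha_quot G ?a j i"
    using ij by (simp add: alpha_quot_mult[OF a])
  also have "\<dots> = alpha_quot G ?a j i"
    using one alpha_quot_closed[OF a, of j i] ij by simp
  finally have "s i \<in> G_plus G ?a {i, j}"
    using si alpha_quot_in_G_plus[of j "{i, j}" i] by simp
  moreover have "s i \<in> G_plus G ?a {i - 1, i}"
    using si alpha_quot_in_G_plus[of "i - 1" "{i - 1, i}" i ?a] by simp
  moreover have "G_plus G ?a {i - 1, i} \<inter> G_plus G ?a {i, j} = G_plus G ?a {i}"
    using int[of "{i - 1, i}" "{i, j}"] ij by simp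
  moreover have "G_plus G ?a {i} = {\<one>}"
    using ij by (intro G_plus_trivial[OF a]) auto
  ultimately show False
    using ne by blast
qed

text \<open>An entry \<open>\<sigma>\<^sub>i = 1\<close> can be dropped from a product of two neighbouring entries: the product is an
  involution, the other entry is not. A neighbour exists because there are at least two entries.\<close>

lemma entry_nontrivial:
  assumes s: "s \<in> tuples G n" and n: "n \<ge> 3"
    and invol: "\<And>i j. 1 \<le> i \<Longrightarrow> i < j \<Longrightarrow> j \<le> n - 1 \<Longrightarrow> elem_order G (consec_prod G s i j) = 2"
    and not_invol: "\<And>i. i \<in> {1..n - 1} \<Longrightarrow> elem_order G (s i) \<noteq> 2"
    and i: "i \<in> {1..n - 1}"
  shows "s i \<noteq> \<one>"
proof
  assume one: "s i = \<one>"
  have cl: "s k \<in> carrier G" if "k \<in> {1..n - 1}" for k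
    using s that by (auto simp: tuples_def)
  have two: "consec_prod G s k (k + 1) = s k \<otimes> s (k + 1)" if "1 \<le> k" "k + 1 \<le> n - 1" for k
    using that cl[of "k + 1"] by (simp add: consec_prod_def upto_rec1)
  show False
  proof (cases "i = n - 1")
    case True
    then show False
      using two[of "i - 1"] invol[of "i - 1" i] not_invol[of "i - 1"] cl[of "i - 1"] one n by simp
  next
    case False
    then show False
      using two[of i] invol[of i "i + 1"] not_invol[of "i + 1"] cl[of "i + 1"] one i by simp
  qed
qed

section \<open>The bijection\<close>

lemma phi_in_set_B_iff:
  assumes s: "s \<in> tuples G n" and n: "n \<ge> 3"
  shows "phi G n s \<in> set_B G n \<longleftrightarrow> s \<in> set_A G n"
proof -
  let ?int = "\<forall>J K. J \<subseteq> {0..n - 1} \<and> K \<subseteq> {0..n - 1} \<and> card J \<ge> 2 \<and> card K \<ge> 2 \<longrightarrow>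
      G_plus G (phi G n s) J \<inter> G_plus G (phi G n s) K = G_plus G (phi G n s) (J \<inter> K)"
  let ?ordA = "(\<forall>i\<in>{1..n - 1}. elem_order G (s i) > 2) \<and>
      (\<forall>i j. 1 \<le> i \<and> i < j \<and> j \<le> n - 1 \<longrightarrow> consec_prod G s i j [^] (2::nat) = \<one>)"
  let ?ordB = "(\<forall>i j. 1 \<le> i \<and> i < j \<and> j \<le> n - 1 \<longrightarrow> elem_order G (consec_prod G s i j) = 2) \<and>
      (\<forall>i\<in>{1..n - 1}. elem_order G (s i) \<noteq> 2)"
  have cl: "s i \<in> carrier G" if "i \<in> {1..n - 1}" for i
    using s that by (auto simp: tuples_def)
  have prod_cl: "consec_prod G s i j \<in> carrier G" if "1 \<le> i" "j \<le> n - 1" for i j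
    using consec_prod_closed[OF tuple_image_subset[OF s that]] .
  have "?ordA \<longleftrightarrow> ?ordB" if int: ?int
  proof
    assume A: ?ordA
    have entry: "s i \<noteq> \<one> \<and> elem_order G (s i) \<noteq> 2" if "i \<in> {1..n - 1}" for i
      using A elem_order_gt_2_iff[OF cl[OF that]] that by blast
    have "elem_order G (consec_prod G s i j) = 2" if ij: "1 \<le> i" "i < j" "j \<le> n - 1" for i j
    proof -
      have "consec_prod G s i j \<noteq> \<one>"
        using int ij entry[of i] by (intro consec_prod_nontrivial[OF s]) auto
      then show ?thesis
        using A ij elem_order_eq_2_iff[OF prod_cl[of i j]] by blast
    qed
    then show ?ordB
      using entry by blast
  next
    assume B: ?ordB
    then have "s i \<noteq> \<one>" if "i \<in> {1..n - 1}" for i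
      using that by (intro entry_nontrivial[OF s n]) auto
    then have "elem_order G (s i) > 2" if "i \<in> {1..n - 1}" for i
      using B elem_order_gt_2_iff[OF cl[OF that]] that by blast
    moreover have "consec_prod G s i j [^] (2::nat) = \<one>" if "1 \<le> i" "i < j" "j \<le> n - 1" for i j
      using B that elem_order_eq_2_iff[OF prod_cl[of i j]] by blast
    ultimately show ?ordA by blast
  qed
  then show ?thesis
    unfolding set_A_def set_B_def mem_Collect_eq intersection_property_iff[OF s]
      alpha_quot_order_iff[OF s] generate_phi[OF s]
    using s phi_in_tuples[OF s] by argo
qed

end

theorem theorem4p3:
  fixes G :: "('a, 'b) monoid_scheme" and n :: int
  assumes "group G" and "n \<ge> 3"
  shows "bij_betw (phi G n) (set_A G n) (set_B G n)"
proof -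
  interpret group G by (rule assms(1))
  have sub: "set_A G n \<subseteq> tuples G n" "set_B G n \<subseteq> tuples G n"
    by (auto simp: set_A_def set_B_def)
  have "phi G n ` set_A G n = set_B G n"
  proof
    show "phi G n ` set_A G n \<subseteq> set_B G n"
      using phi_in_set_B_iff assms(2) sub(1) by blast
    show "set_B G n \<subseteq> phi G n ` set_A G n"
    proof
      fix a assume a: "a \<in> set_B G n"
      then obtain s where "s \<in> tuples G n" "a = phi G n s"
        using sub(2) bij_betw_imp_surj_on[OF bij_betw_phi_tuples[of n]] by blast
      then show "a \<in> phi G n ` set_A G n"
        using phi_in_set_B_iff assms(2) a by blast
    qed
  qed
  then show ?thesis
    by (rule bij_betw_subset[OF bij_betw_phi_tuples sub(1)])
qed

end
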